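(* Let $(\Omega,\{R_i\}_{i=0}^m)$ be a symmetric association scheme on triples of order $v=|\Omega|$ with intersection numbers $p_{abc}^\ell$ and adjacency matrices $A_0,\dots,A_m$, and let $I\subseteq\{0,1,\dots,m\}$ be a nonempty subset with either $\{1,2,3\}\subseteq I$ or $I\cap\{1,2,3\}=\emptyset$. Then the $v\times v\times v$ array $A=\sum_{i\in I}A_i$ is a $\mathcal{C}^3_3(v,k,\lambda)$-cube, where $$k=\sum_{a,b\in I}\sum_{c=0}^m\big(p_{abc}^0+(v-1)p_{abc}^3\big),\qquad \lambda=\sum_{a,b\in I}\sum_{c,\ell=0}^m p_{abc}^\ell\, n_\ell .$$
   Context: Association scheme on triples (AST): let $\Omega$ be a nonempty finite set, $m\ge 4$, and $\{R_0,\dots,R_m\}$ a partition of $\Omega^3$ into nonempty sets. For a permutation $\sigma$ of $\{1,2,3\}$ put $\sigma(R_i)=\{(x_{\sigma(1)},x_{\sigma(2)},x_{\sigma(3)})\mid (x_1,x_2,x_3)\in R_i\}$. The pair $(\Omega,\{R_i\}_{i=0}^m)$ is an AST of order $|\Omega|$ if: (I) $R_0=\{(x,x,x)\}$, $R_1=\{(x,y,y)\mid x\ne y\}$, $R_2=\{(x,y,x)\mid x\neq y\}$, $R_3=\{(x,x,y)\mid x\ne y\}$ (with $x,y\in\Omega$); (II) for every $i$ and $\sigma$, $\sigma(R_i)=R_j$ for some $j$; (III) for distinct $y,z\in\Omega$ and every $i$, $|\{x\in\Omega\mid (x,y,z)\in R_i\}|$ depends only on $i$; (IV) for all $a,b,c,\ell\in\{0,\dots,m\}$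 and $(x,y,z)\in R_\ell$, the number $|\{w\in\Omega\mid (w,y,z)\in R_a,\ (x,w,z)\in R_b,\ (x,y,w)\in R_c\}|$ depends only on $a,b,c,\ell$; it is the intersection number $p_{abc}^\ell$. The AST is symmetric if $\sigma(R_i)=R_i$ for every $i\in\{4,\dots,m\}$ and every permutation $\sigma$ of $\{1,2,3\}$. Put $n_\ell=|\{z\in\Omega\mid (x,y,z)\in R_\ell\}|$ for distinct $x,y\in\Omega$ (independent of the choice of $x\ne y$; in particular $n_0=n_3=0$ and $n_1=n_2=1$). The adjacency matrix $A_i$ is the $v\times v\times v$ array indexed by $\Omega$ with $A_i(x,y,z)=1$ if $(x,y,z)\in R_i$ and $0$ otherwise. For a $v\times v\times v$ array indexed by $\Omega$, a layer is obtained by fixing one of the three coordinates; two layers are parallel if they fix the same coordinate, to different values; their scalar product is the sum over all positions of the product of corresponding entries. A $\mathcal{C}^3_3(v,k,\lambda)$-cube is a $v\times v\times v$ array over $\{0,1\}$ such that every layer (in each of the three directions) contains exactly $k$ ones and every two parallel layers have scalar product $\lambda$. *)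

theory Defs
  imports Main "HOL-Library.Disjoint_Sets" "HOL-Combinatorics.Permutations"
begin

section \<open>Association schemes on triples\<close>

fun coord :: "'a \<times> 'a \<times> 'a \<Rightarrow> nat \<Rightarrow> 'a" where
  "coord (x, y, z) i = (if i = 1 then x else if i = 2 then y else z)"

definition permute_rel :: "(nat \<Rightarrow> nat) \<Rightarrow> ('a \<times> 'a \<times> 'a) set \<Rightarrow> ('a \<times> 'a \<times> 'a) set" where
  "permute_rel \<sigma> S = (\<lambda>t. (coord t (\<sigma> 1), coord t (\<sigma> 2), coord t (\<sigma> 3))) ` S"

text \<open>
  The relations are given as a family indexed by the natural numbers of which only the members
  with index in \<open>{0..m}\<close> matter. \<open>partition_on\<close> includes that the blocks are nonempty;
  \<open>inj_on\<close> says that different indices denote different blocks.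
\<close>

locale ast =
  fixes \<Omega> :: "'a set" and m :: nat and R :: "nat \<Rightarrow> ('a \<times> 'a \<times> 'a) set"
  assumes finite_carrier: "finite \<Omega>"
    and nonempty_carrier: "\<Omega> \<noteq> {}"
    and m_ge_4: "m \<ge> 4"
    and partition: "partition_on (\<Omega> \<times> \<Omega> \<times> \<Omega>) (R ` {0..m})"
    and inj_R: "inj_on R {0..m}"
    and R_0: "R 0 = {(x, x, x) | x. x \<in> \<Omega>}"
    and R_1: "R 1 = {(x, y, y) | x y. x \<in> \<Omega> \<and> y \<in> \<Omega> \<and> x \<noteq> y}"
    and R_2: "R 2 = {(x, y, x) | x y. x \<in> \<Omega> \<and> y \<in> \<Omega> \<and> x \<noteq> y}"
    and R_3: "R 3 = {(x, x, y) | x y. x \<in> \<Omega> \<and> y \<in> \<Omega> \<and> x \<noteq> y}"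
    and permute_closed:
      "\<forall>i\<in>{0..m}. \<forall>\<sigma>. \<sigma> permutes {1, 2, 3} \<longrightarrow> (\<exists>j\<in>{0..m}. permute_rel \<sigma> (R i) = R j)"
    and valency_const:
      "\<forall>i\<in>{0..m}. \<exists>n. \<forall>y\<in>\<Omega>. \<forall>z\<in>\<Omega>. y \<noteq> z \<longrightarrow> card {x \<in> \<Omega>. (x, y, z) \<in> R i} = n"
    and intersection_const:
      "\<forall>a\<in>{0..m}. \<forall>b\<in>{0..m}. \<forall>c\<in>{0..m}. \<forall>l\<in>{0..m}. \<exists>p. \<forall>x y z. (x, y, z) \<in> R l \<longrightarrow>
         card {w \<in> \<Omega>. (w, y, z) \<in> R a \<and> (x, w, z) \<in> R b \<and> (x, y, w) \<in> R c} = p"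

locale symmetric_ast = ast +
  assumes symmetric: "\<forall>i\<in>{4..m}. \<forall>\<sigma>. \<sigma> permutes {1, 2, 3} \<longrightarrow> permute_rel \<sigma> (R i) = R i"

text \<open>The intersection number \<open>p\<close> with lower indices \<open>a, b, c\<close> and upper index \<open>l\<close>.\<close>

definition intersection_number ::
    "'a set \<Rightarrow> (nat \<Rightarrow> ('a \<times> 'a \<times> 'a) set) \<Rightarrow> nat \<Rightarrow> nat \<Rightarrow> nat \<Rightarrow> nat \<Rightarrow> nat" where
  "intersection_number \<Omega> R a b c l = (THE p. \<forall>x y z. (x, y, z) \<in> R l \<longrightarrow>
     card {w \<in> \<Omega>. (w, y, z) \<in> R a \<and> (x, w, z) \<in> R b \<and> (x, y, w) \<in> R c} = p)"

text \<open>
  The number \<open>n\<close> with index \<open>l\<close>. The free coordinate is the third one, whereas it is the first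
  one in the axiom \<open>valency_const\<close>; closure under permutations relates the two.
\<close>

definition valency :: "'a set \<Rightarrow> (nat \<Rightarrow> ('a \<times> 'a \<times> 'a) set) \<Rightarrow> nat \<Rightarrow> nat" where
  "valency \<Omega> R l = (THE n. \<forall>x\<in>\<Omega>. \<forall>y\<in>\<Omega>. x \<noteq> y \<longrightarrow> card {z \<in> \<Omega>. (x, y, z) \<in> R l} = n)"

section \<open>Three-dimensional arrays and cubes\<close>

text \<open>An array indexed by \<open>\<Omega>\<close> is a curried function; only its values on \<open>\<Omega>\<close> matter.\<close>

type_synonym 'a array3 = "'a \<Rightarrow> 'a \<Rightarrow> 'a \<Rightarrow> nat"

definition adjacency :: "(nat \<Rightarrow> ('a \<times> 'a \<times> 'a) set) \<Rightarrow> nat \<Rightarrow> 'a array3" where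
  "adjacency R i x y z = (if (x, y, z) \<in> R i then 1 else 0)"

text \<open>\<open>layer A d u\<close> fixes coordinate number \<open>d\<close> (one of 1, 2, 3) to \<open>u\<close>.\<close>

definition layer :: "'a array3 \<Rightarrow> nat \<Rightarrow> 'a \<Rightarrow> 'a \<Rightarrow> 'a \<Rightarrow> nat" where
  "layer A d u s t = (if d = 1 then A u s t else if d = 2 then A s u t else A s t u)"

definition scalar_product :: "'a set \<Rightarrow> ('a \<Rightarrow> 'a \<Rightarrow> nat) \<Rightarrow> ('a \<Rightarrow> 'a \<Rightarrow> nat) \<Rightarrow> nat" where
  "scalar_product \<Omega> L L' = (\<Sum>s\<in>\<Omega>. \<Sum>t\<in>\<Omega>. L s t * L' s t)"

definition is_C33_cube :: "'a set \<Rightarrow> nat \<Rightarrow> nat \<Rightarrow> nat \<Rightarrow> 'a array3 \<Rightarrow> bool" where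
  "is_C33_cube \<Omega> v k mu A \<longleftrightarrow>
     finite \<Omega> \<and> card \<Omega> = v \<and>
     (\<forall>x\<in>\<Omega>. \<forall>y\<in>\<Omega>. \<forall>z\<in>\<Omega>. A x y z \<in> {0, 1}) \<and>
     (\<forall>d\<in>{1, 2, 3}. \<forall>u\<in>\<Omega>. card {(s, t) \<in> \<Omega> \<times> \<Omega>. layer A d u s t = 1} = k) \<and>
     (\<forall>d\<in>{1, 2, 3}. \<forall>u\<in>\<Omega>. \<forall>u'\<in>\<Omega>. u \<noteq> u' \<longrightarrow>
        scalar_product \<Omega> (layer A d u) (layer A d u') = mu)"

end

theory Submission imports Defs begin

text \<open>
  The array is invariant under permutations of its arguments, so only the layers with fixed first
  coordinate matter. Summing \<open>p\<close> over \<open>a, b \<in> I\<close> and over all \<open>c\<close> gives, for \<open>(x, y, z)\<close> in the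
  \<open>l\<close>-th relation, the sum of \<open>A(w, y, z) A(x, w, z)\<close> over \<open>w\<close>, that is, the contribution of \<open>z\<close> to
  the scalar product of the layers at \<open>x\<close> and \<open>y\<close>. Summing over \<open>z\<close> gives the scalar product for
  \<open>x \<noteq> y\<close> and, because the entries are 0 and 1, the number of ones for \<open>x = y\<close>.
\<close>

section \<open>Coordinate swaps and sums of indicators\<close>

lemma adjacency_eq_of_bool: "adjacency R i x y z = of_bool ((x, y, z) \<in> R i)"
  by (simp add: adjacency_def)

text \<open>The swaps (1 2) and (2 3) generate all permutations of the coordinates, so they suffice
  for the symmetry of the array. The swap (1 3) moves the free coordinate in
  \<open>valency_const\<close> to the third place.\<close>

lemma mem_permute_rel_transpose_12:
  "(y, x, z) \<in> permute_rel (transpose 1 2) S \<longleftrightarrow> (x, y, z) \<in> S"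
  by (force simp: permute_rel_def transpose_def)

lemma mem_permute_rel_transpose_23:
  "(x, z, y) \<in> permute_rel (transpose 2 3) S \<longleftrightarrow> (x, y, z) \<in> S"
  by (force simp: permute_rel_def transpose_def)

lemma mem_permute_rel_transpose_13:
  "(z, y, x) \<in> permute_rel (transpose 1 3) S \<longleftrightarrow> (x, y, z) \<in> S"
  by (force simp: permute_rel_def transpose_def)

lemma card_eq_sum_of_bool:
  assumes "finite A"
  shows "card {x \<in> A. P x} = (\<Sum>x\<in>A. of_bool (P x))"
  using assms by (simp add: of_bool_def sum.If_cases Int_def)

definition union_array :: "(nat \<Rightarrow> ('a \<times> 'a \<times> 'a) set) \<Rightarrow> nat set \<Rightarrow> 'a array3" where
  "union_array R I x y z = (\<Sum>i\<in>I. adjacency R i x y z)"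

section \<open>Intersection numbers and valencies as sums of array entries\<close>

context ast
begin

lemma R_subset: "i \<in> {0..m} \<Longrightarrow> R i \<subseteq> \<Omega> \<times> \<Omega> \<times> \<Omega>"
  unfolding partition_onD1[OF partition] by (rule UN_upper)

lemma R_disjoint:
  assumes "i \<in> {0..m}" "j \<in> {0..m}" "t \<in> R i" "t \<in> R j"
  shows "i = j"
proof -
  have "disjoint (R ` {0..m})"
    using partition by (simp add: partition_on_def)
  then have "R i = R j"
    using assms unfolding disjoint_def by blast
  then show ?thesis
    using inj_R assms(1,2) by (auto dest: inj_onD)
qed

lemma R_covers:
  assumes "x \<in> \<Omega>" "y \<in> \<Omega>" "z \<in> \<Omega>"
  obtains i where "i \<in> {0..m}" "(x, y, z) \<in> R i"
proof -
  have "(x, y, z) \<in> \<Union> (R ` {0..m})"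
    using partition assms by (simp add: partition_on_def)
  then show ?thesis
    using that by blast
qed

text \<open>The relations are disjoint and distinct indices name distinct relations, so at most one
  summand is 1.\<close>

lemma union_array_eq_of_bool:
  assumes "I \<subseteq> {0..m}"
  shows "union_array R I x y z = of_bool (\<exists>i\<in>I. (x, y, z) \<in> R i)"
proof (cases "\<exists>i\<in>I. (x, y, z) \<in> R i")
  case True
  then obtain i where i: "i \<in> I" "(x, y, z) \<in> R i"
    by blast
  have "adjacency R j x y z = (if j = i then 1 else 0)" if "j \<in> I" for j
  proof (cases "(x, y, z) \<in> R j")
    case True
    then have "i = j"
      using R_disjoint[OF subsetD[OF assms i(1)] subsetD[OF assms that] i(2)] by blast
    with True show ?thesis
      by (simp add: adjacency_def)
  next
    case False
    with i(2) show ?thesis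
      by (auto simp: adjacency_def)
  qed
  then have "union_array R I x y z = (\<Sum>j\<in>I. if j = i then 1 else 0)"
    by (simp add: union_array_def)
  also have "\<dots> = 1"
    using i(1) finite_subset[OF assms finite_atLeastAtMost] by simp
  finally show ?thesis
    using True by simp
next
  case False
  then show ?thesis
    by (simp add: union_array_def adjacency_def)
qed

lemma sum_adjacency_eq_1:
  assumes "x \<in> \<Omega>" "y \<in> \<Omega>" "z \<in> \<Omega>"
  shows "(\<Sum>i=0..m. adjacency R i x y z) = 1"
proof -
  have "\<exists>i\<in>{0..m}. (x, y, z) \<in> R i"
    using R_covers[OF assms] by blast
  then show ?thesis
    using union_array_eq_of_bool[of "{0..m}" x y z] by (simp only: union_array_def of_bool_eq subset_refl simp_thms)
qed

text \<open>The definite description denotes: \<open>intersection_const\<close> gives existence, and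
  the triple \<open>(x, y, z)\<close> gives uniqueness, since it forces every candidate to equal its
  own count.\<close>

lemma intersection_number_eq_card:
  assumes "a \<in> {0..m}" "b \<in> {0..m}" "c \<in> {0..m}" "l \<in> {0..m}" and xyz: "(x, y, z) \<in> R l"
  shows "intersection_number \<Omega> R a b c l =
    card {w \<in> \<Omega>. (w, y, z) \<in> R a \<and> (x, w, z) \<in> R b \<and> (x, y, w) \<in> R c}"
proof -
  let ?c = "\<lambda>x y z. card {w \<in> \<Omega>. (w, y, z) \<in> R a \<and> (x, w, z) \<in> R b \<and> (x, y, w) \<in> R c}"
  obtain q where q: "\<forall>x y z. (x, y, z) \<in> R l \<longrightarrow> ?c x y z = q"
    using bspec[OF bspec[OF bspec[OF bspec[OF intersection_const assms(1)] assms(2)] assms(3)] assms(4)]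
    by (rule exE)
  have c: "?c x y z = p" if "\<forall>x y z. (x, y, z) \<in> R l \<longrightarrow> ?c x y z = p" for p
    using that[rule_format, OF xyz] .
  have "intersection_number \<Omega> R a b c l = q"
    unfolding intersection_number_def
    using q by (rule the_equality) (use c[OF q] in \<open>simp only: c\<close>)
  then show ?thesis
    using c[OF q] by (simp only:)
qed

lemma valency_eq_card:
  assumes l: "l \<in> {0..m}" and xy: "x \<in> \<Omega>" "y \<in> \<Omega>" "x \<noteq> y"
  shows "valency \<Omega> R l = card {z \<in> \<Omega>. (x, y, z) \<in> R l}"
proof -
  have "transpose 1 3 permutes {1, 2, 3 :: nat}"
    by (rule permutes_swap_id) auto
  then obtain j where j: "j \<in> {0..m}" "permute_rel (transpose 1 3) (R l) = R j"
    using permute_closed l by blast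
  have R_j: "(z, y, x) \<in> R j \<longleftrightarrow> (x, y, z) \<in> R l" for x y z
    using mem_permute_rel_transpose_13[of z y x "R l"] unfolding j(2) .
  let ?c = "\<lambda>x y. card {z \<in> \<Omega>. (x, y, z) \<in> R l}"
  obtain q where q': "\<forall>y\<in>\<Omega>. \<forall>z\<in>\<Omega>. y \<noteq> z \<longrightarrow> card {x \<in> \<Omega>. (x, y, z) \<in> R j} = q"
    using bspec[OF valency_const j(1)] by (rule exE)
  \<comment> \<open>Reversing triples also exchanges the two fixed points; this is harmless because
    the count is the same for all ordered pairs of distinct points.\<close>
  have q: "\<forall>x\<in>\<Omega>. \<forall>y\<in>\<Omega>. x \<noteq> y \<longrightarrow> ?c x y = q"
    using q'[rule_format] unfolding R_j by (metis (no_types))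
  have c: "?c x y = p" if "\<forall>x\<in>\<Omega>. \<forall>y\<in>\<Omega>. x \<noteq> y \<longrightarrow> ?c x y = p" for p
    using that[rule_format, OF xy] .
  have "valency \<Omega> R l = q"
    unfolding valency_def
    using q by (rule the_equality) (use c[OF q] in \<open>simp only: c\<close>)
  then show ?thesis
    using c[OF q] by (simp only:)
qed

lemma sum_intersection_number:
  assumes I: "I \<subseteq> {0..m}" and l: "l \<in> {0..m}" and xyz: "(x, y, z) \<in> R l"
  shows "(\<Sum>a\<in>I. \<Sum>b\<in>I. \<Sum>c=0..m. intersection_number \<Omega> R a b c l) =
    (\<Sum>w\<in>\<Omega>. union_array R I w y z * union_array R I x w z)"
proof -
  have mem: "x \<in> \<Omega>" "y \<in> \<Omega>" "z \<in> \<Omega>"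
    using R_subset[OF l] xyz by auto
  let ?f = "\<lambda>a b c w. adjacency R a w y z * adjacency R b x w z * adjacency R c x y w"
  have "intersection_number \<Omega> R a b c l = (\<Sum>w\<in>\<Omega>. ?f a b c w)"
    if "a \<in> I" "b \<in> I" "c \<in> {0..m}" for a b c
  proof -
    have "a \<in> {0..m}" "b \<in> {0..m}"
      using that I by auto
    then show ?thesis
      using that(3) l xyz
      by (simp only: intersection_number_eq_card card_eq_sum_of_bool[OF finite_carrier]
          adjacency_eq_of_bool of_bool_conj mult.assoc)
  qed
  then have "(\<Sum>a\<in>I. \<Sum>b\<in>I. \<Sum>c=0..m. intersection_number \<Omega> R a b c l) =
      (\<Sum>a\<in>I. \<Sum>b\<in>I. \<Sum>c=0..m. \<Sum>w\<in>\<Omega>. ?f a b c w)"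
    by (intro sum.cong refl) simp
  \<comment> \<open>Each triple \<open>(x, y, w)\<close> lies in exactly one relation, so summing
    over all \<open>c\<close> removes the third indicator.\<close>
  also have "\<dots> = (\<Sum>a\<in>I. \<Sum>b\<in>I. \<Sum>w\<in>\<Omega>. adjacency R a w y z * adjacency R b x w z)"
  proof (intro sum.cong refl)
    fix a b
    have "(\<Sum>c=0..m. \<Sum>w\<in>\<Omega>. ?f a b c w) =
        (\<Sum>w\<in>\<Omega>. adjacency R a w y z * adjacency R b x w z * (\<Sum>c=0..m. adjacency R c x y w))"
      by (subst sum.swap) (simp only: sum_distrib_left)
    then show "(\<Sum>c=0..m. \<Sum>w\<in>\<Omega>. ?f a b c w) =
        (\<Sum>w\<in>\<Omega>. adjacency R a w y z * adjacency R b x w z)"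
      using mem by (simp add: sum_adjacency_eq_1)
  qed
  \<comment> \<open>With the sum over \<open>w\<close> moved outermost, the sums over
    \<open>a\<close> and \<open>b\<close> factor into two array entries.\<close>
  also have "\<dots> = (\<Sum>a\<in>I. \<Sum>w\<in>\<Omega>. \<Sum>b\<in>I. adjacency R a w y z * adjacency R b x w z)"
    by (intro sum.cong refl sum.swap)
  also have "\<dots> = (\<Sum>w\<in>\<Omega>. \<Sum>a\<in>I. \<Sum>b\<in>I. adjacency R a w y z * adjacency R b x w z)"
    by (rule sum.swap)
  also have "\<dots> = (\<Sum>w\<in>\<Omega>. union_array R I w y z * union_array R I x w z)"
    by (simp add: union_array_def sum_product)
  finally show ?thesis .
qed

text \<open>For \<open>x\<close> and \<open>y\<close> distinct, \<open>valency\<close> counts the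
  \<open>z\<close> with \<open>(x, y, z)\<close> in \<open>R l\<close>. The weighted sum over
  \<open>l\<close> is thus a sum over \<open>z\<close>, grouped by the relation containing
  \<open>(x, y, z)\<close>.\<close>

lemma sum_intersection_number_valency:
  assumes I: "I \<subseteq> {0..m}" and xy: "x \<in> \<Omega>" "y \<in> \<Omega>" "x \<noteq> y"
  shows "(\<Sum>a\<in>I. \<Sum>b\<in>I. \<Sum>c=0..m. \<Sum>l=0..m. intersection_number \<Omega> R a b c l * valency \<Omega> R l) =
    (\<Sum>z\<in>\<Omega>. \<Sum>w\<in>\<Omega>. union_array R I w y z * union_array R I x w z)"
proof -
  let ?P = "\<lambda>l. \<Sum>a\<in>I. \<Sum>b\<in>I. \<Sum>c=0..m. intersection_number \<Omega> R a b c l"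
  let ?Q = "\<lambda>z. \<Sum>w\<in>\<Omega>. union_array R I w y z * union_array R I x w z"
  have "(\<Sum>a\<in>I. \<Sum>b\<in>I. \<Sum>c=0..m. \<Sum>l=0..m. intersection_number \<Omega> R a b c l * valency \<Omega> R l) =
      (\<Sum>a\<in>I. \<Sum>b\<in>I. \<Sum>l=0..m. \<Sum>c=0..m. intersection_number \<Omega> R a b c l * valency \<Omega> R l)"
    by (intro sum.cong refl sum.swap)
  also have "\<dots> = (\<Sum>a\<in>I. \<Sum>l=0..m. \<Sum>b\<in>I. \<Sum>c=0..m. intersection_number \<Omega> R a b c l * valency \<Omega> R l)"
    by (intro sum.cong refl sum.swap)
  also have "\<dots> = (\<Sum>l=0..m. \<Sum>a\<in>I. \<Sum>b\<in>I. \<Sum>c=0..m. intersection_number \<Omega> R a b c l * valency \<Omega> R l)"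
    by (rule sum.swap)
  also have "\<dots> = (\<Sum>l=0..m. ?P l * valency \<Omega> R l)"
    by (simp only: sum_distrib_right)
  also have "\<dots> = (\<Sum>l=0..m. \<Sum>z\<in>\<Omega>. ?P l * adjacency R l x y z)"
    using xy by (intro sum.cong refl)
      (simp add: valency_eq_card card_eq_sum_of_bool finite_carrier adjacency_eq_of_bool
        flip: sum_distrib_left)
  \<comment> \<open>Where the indicator is 1, \<open>?P l\<close> equals \<open>?Q z\<close>;
    elsewhere both products vanish. The first factor then no longer depends on
    \<open>l\<close>.\<close>
  also have "\<dots> = (\<Sum>l=0..m. \<Sum>z\<in>\<Omega>. ?Q z * adjacency R l x y z)"
  proof (intro sum.cong refl)
    fix l z
    assume "l \<in> {0..m}"
    then show "?P l * adjacency R l x y z = ?Q z * adjacency R l x y z"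
      using sum_intersection_number[OF I, of l x y z]
      by (cases "(x, y, z) \<in> R l") (simp_all add: adjacency_def)
  qed
  also have "\<dots> = (\<Sum>z\<in>\<Omega>. \<Sum>l=0..m. ?Q z * adjacency R l x y z)"
    by (rule sum.swap)
  also have "\<dots> = (\<Sum>z\<in>\<Omega>. ?Q z * (\<Sum>l=0..m. adjacency R l x y z))"
    by (simp only: sum_distrib_left)
  also have "\<dots> = (\<Sum>z\<in>\<Omega>. ?Q z)"
    using xy by (simp add: sum_adjacency_eq_1)
  finally show ?thesis .
qed

text \<open>The triple \<open>(x, x, z)\<close> lies in \<open>R 0\<close> for \<open>z = x\<close>
  and in \<open>R 3\<close> for every other \<open>z\<close>, which explains the two upper indices
  and their weights.\<close>

lemma sum_intersection_number_diagonal: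
  assumes I: "I \<subseteq> {0..m}" and x: "x \<in> \<Omega>"
  shows "(\<Sum>a\<in>I. \<Sum>b\<in>I. \<Sum>c=0..m.
      (intersection_number \<Omega> R a b c 0 + (card \<Omega> - 1) * intersection_number \<Omega> R a b c 3)) =
    (\<Sum>z\<in>\<Omega>. \<Sum>w\<in>\<Omega>. union_array R I w x z * union_array R I x w z)"
proof -
  let ?P = "\<lambda>l. \<Sum>a\<in>I. \<Sum>b\<in>I. \<Sum>c=0..m. intersection_number \<Omega> R a b c l"
  let ?Q = "\<lambda>z. \<Sum>w\<in>\<Omega>. union_array R I w x z * union_array R I x w z"
  have 0: "?P 0 = ?Q x"
    by (rule sum_intersection_number[OF I]) (use x R_0 in auto)
  have 3: "?P 3 = ?Q z" if "z \<in> \<Omega> - {x}" for z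
    by (rule sum_intersection_number[OF I]) (use x that m_ge_4 R_3 in auto)
  have "(\<Sum>a\<in>I. \<Sum>b\<in>I. \<Sum>c=0..m.
      (intersection_number \<Omega> R a b c 0 + (card \<Omega> - 1) * intersection_number \<Omega> R a b c 3)) =
      ?P 0 + (card \<Omega> - 1) * ?P 3"
    by (simp only: sum.distrib sum_distrib_left)
  \<comment> \<open>Since \<open>x\<close> belongs to the carrier, the subtraction on naturals is
    exact and counts the points other than \<open>x\<close>.\<close>
  also have "(card \<Omega> - 1) * ?P 3 = (\<Sum>z\<in>\<Omega> - {x}. ?P 3)"
    by (simp only: sum_constant card_Diff_singleton[OF x] of_nat_id)
  also have "\<dots> = (\<Sum>z\<in>\<Omega> - {x}. ?Q z)"
    by (rule sum.cong[OF refl 3])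
  also have "?P 0 + \<dots> = (\<Sum>z\<in>\<Omega>. ?Q z)"
    unfolding 0 by (rule sum.remove[OF finite_carrier x, symmetric])
  finally show ?thesis .
qed

end

section \<open>Invariance of the array under coordinate permutations\<close>

context symmetric_ast
begin

text \<open>Both swaps fix \<open>R 0\<close> and, by symmetry of the scheme, every
  \<open>R i\<close> with \<open>i\<close> at least 4. The swap (1 2) exchanges \<open>R 1\<close>
  and \<open>R 2\<close>, and (2 3) exchanges \<open>R 2\<close> and \<open>R 3\<close>; so
  \<open>I\<close> has to contain all three of these indices or none.\<close>

lemma union_invariant:
  assumes I: "I \<subseteq> {0..m}" "{1, 2, 3} \<subseteq> I \<or> I \<inter> {1, 2, 3} = {}"
    and xyz: "\<exists>i\<in>I. (x, y, z) \<in> R i"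
  shows "\<exists>i\<in>I. (y, x, z) \<in> R i" and "\<exists>i\<in>I. (x, z, y) \<in> R i"
proof -
  obtain i where i: "i \<in> I" "(x, y, z) \<in> R i"
    using xyz by blast
  consider "i = 0" | "i \<in> {1, 2, 3}" | "i \<in> {4..m}"
    using i(1) I(1) by fastforce
  then have "(\<exists>i\<in>I. (y, x, z) \<in> R i) \<and> (\<exists>i\<in>I. (x, z, y) \<in> R i)"
  proof cases
    case 1
    then show ?thesis
      using i by (intro conjI bexI[of _ 0]) (auto simp: R_0)
  next
    case 2
    then have "{1, 2, 3} \<subseteq> I"
      using I(2) i(1) by blast
    moreover have "\<exists>j\<in>{1, 2, 3}. (y, x, z) \<in> R j" "\<exists>j\<in>{1, 2, 3}. (x, z, y) \<in> R j"
      using 2 i(2) R_1 R_2 R_3 by auto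
    ultimately show ?thesis
      by blast
  next
    case 3
    have "transpose 1 2 permutes {1, 2, 3 :: nat}" "transpose 2 3 permutes {1, 2, 3 :: nat}"
      by (rule permutes_swap_id; simp)+
    then have "permute_rel (transpose 1 2) (R i) = R i" "permute_rel (transpose 2 3) (R i) = R i"
      using symmetric 3 by blast+
    then have "(y, x, z) \<in> R i" "(x, z, y) \<in> R i"
      using i(2) mem_permute_rel_transpose_12 mem_permute_rel_transpose_23 by metis+
    then show ?thesis
      using i(1) by blast
  qed
  then show "\<exists>i\<in>I. (y, x, z) \<in> R i" and "\<exists>i\<in>I. (x, z, y) \<in> R i"
    by blast+
qed

lemma union_array_symmetric:
  assumes "I \<subseteq> {0..m}" "{1, 2, 3} \<subseteq> I \<or> I \<inter> {1, 2, 3} = {}"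
  shows "union_array R I y x z = union_array R I x y z"
    and "union_array R I x z y = union_array R I x y z"
proof -
  \<comment> \<open>A swap is its own inverse, so one implication yields the equivalence.\<close>
  have "(\<exists>i\<in>I. (y, x, z) \<in> R i) \<longleftrightarrow> (\<exists>i\<in>I. (x, y, z) \<in> R i)"
    using union_invariant(1)[OF assms] by blast
  then show "union_array R I y x z = union_array R I x y z"
    by (simp only: union_array_eq_of_bool[OF assms(1)])
  have "(\<exists>i\<in>I. (x, z, y) \<in> R i) \<longleftrightarrow> (\<exists>i\<in>I. (x, y, z) \<in> R i)"
    using union_invariant(2)[OF assms] by blast
  then show "union_array R I x z y = union_array R I x y z"
    by (simp only: union_array_eq_of_bool[OF assms(1)])
qed

lemma layer_union_array:
  assumes "I \<subseteq> {0..m}" "{1, 2, 3} \<subseteq> I \<or> I \<inter> {1, 2, 3} = {}"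
  shows "layer (union_array R I) d u = union_array R I u"
proof (intro ext)
  fix s t
  show "layer (union_array R I) d u s t = union_array R I u s t"
    using union_array_symmetric(1)[OF assms, of s u t] union_array_symmetric(2)[OF assms, of s t u]
    by (simp add: layer_def)
qed

end

section \<open>The cube property\<close>

theorem theorem4p15:
  fixes \<Omega> :: "'a set" and m v :: nat and R :: "nat \<Rightarrow> ('a \<times> 'a \<times> 'a) set"
    and I :: "nat set"
    and p :: "nat \<Rightarrow> nat \<Rightarrow> nat \<Rightarrow> nat \<Rightarrow> nat" and n :: "nat \<Rightarrow> nat"
  assumes "symmetric_ast \<Omega> m R"
    and "v = card \<Omega>"
    and "p = intersection_number \<Omega> R"
    and "n = valency \<Omega> R"
    and "I \<subseteq> {0..m}" and "I \<noteq> {}"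
    and "{1, 2, 3} \<subseteq> I \<or> I \<inter> {1, 2, 3} = {}"
  shows "is_C33_cube \<Omega> v
    (\<Sum>a\<in>I. \<Sum>b\<in>I. \<Sum>c=0..m. (p a b c 0 + (v - 1) * p a b c 3))
    (\<Sum>a\<in>I. \<Sum>b\<in>I. \<Sum>c=0..m. \<Sum>l=0..m. p a b c l * n l)
    (\<lambda>x y z. \<Sum>i\<in>I. adjacency R i x y z)"
proof -
  interpret symmetric_ast \<Omega> m R
    by fact
  let ?A = "union_array R I"
  note sym = union_array_symmetric[OF assms(5,7)]
  have A_eq: "(\<lambda>x y z. \<Sum>i\<in>I. adjacency R i x y z) = ?A"
    by (intro ext) (simp add: union_array_def)
  have idem: "?A x y z * ?A x y z = ?A x y z" for x y z
    by (simp add: union_array_eq_of_bool[OF assms(5)])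
  \<comment> \<open>Swapping the first two arguments turns \<open>?A w y z\<close> into an entry of
    the layer at \<open>y\<close>.\<close>
  have scalar: "(\<Sum>z\<in>\<Omega>. \<Sum>w\<in>\<Omega>. ?A w y z * ?A x w z) = scalar_product \<Omega> (?A x) (?A y)" for x y
    unfolding scalar_product_def
    by (subst sum.swap) (simp add: sym(1)[of _ y] mult.commute)
  \<comment> \<open>Entries are 0 or 1, hence equal to their squares: counting ones is the scalar
    product of a layer with itself.\<close>
  have ones: "card {(s, t) \<in> \<Omega> \<times> \<Omega>. ?A u s t = 1} = scalar_product \<Omega> (?A u) (?A u)" for u
  proof -
    have "card {(s, t) \<in> \<Omega> \<times> \<Omega>. ?A u s t = 1} = card {q \<in> \<Omega> \<times> \<Omega>. ?A u (fst q) (snd q) = 1}"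
      by (rule arg_cong[where f = card]) auto
    also have "\<dots> = (\<Sum>q\<in>\<Omega> \<times> \<Omega>. ?A u (fst q) (snd q))"
      by (simp add: card_eq_sum_of_bool finite_carrier union_array_eq_of_bool[OF assms(5)])
    also have "\<dots> = scalar_product \<Omega> (?A u) (?A u)"
      by (simp add: scalar_product_def idem sum.cartesian_product case_prod_beta)
    finally show ?thesis .
  qed
  show ?thesis
    \<comment> \<open>These rewrites remove the direction \<open>d\<close> from the layers and turn
      both cube conditions into scalar products.\<close>
    unfolding is_C33_cube_def A_eq layer_union_array[OF assms(5,7)] ones assms(2-4)
  proof (intro conjI ballI impI)
    fix u u'
    assume u: "u \<in> \<Omega>"
    show "scalar_product \<Omega> (?A u) (?A u) = (\<Sum>a\<in>I. \<Sum>b\<in>I. \<Sum>c=0..m.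
        (intersection_number \<Omega> R a b c 0 + (card \<Omega> - 1) * intersection_number \<Omega> R a b c 3))"
      unfolding sum_intersection_number_diagonal[OF assms(5) u] scalar ..
    assume u': "u' \<in> \<Omega>" "u \<noteq> u'"
    show "scalar_product \<Omega> (?A u) (?A u') = (\<Sum>a\<in>I. \<Sum>b\<in>I. \<Sum>c=0..m. \<Sum>l=0..m.
        intersection_number \<Omega> R a b c l * valency \<Omega> R l)"
      unfolding sum_intersection_number_valency[OF assms(5) u u'] scalar ..
  qed (simp_all add: finite_carrier union_array_eq_of_bool[OF assms(5)])
qed

end
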